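(* Every core compact $T_0$ space is well-filtered determined.
   Context: A space $X$ is core compact if its lattice $\mathcal O(X)$ of open sets, ordered by inclusion, is a continuous lattice. For a $T_0$ space $Y$, the specialization order is $x\le y$ iff $x\in\overline{\{y\}}$, and $\mathsf{K}(Y)$ is the set of nonempty compact saturated subsets (saturated = upper set in the specialization order). A family $\mathcal K\subseteq \mathsf K(Y)$ is filtered if it is nonempty and for all $K_1,K_2\in\mathcal K$ there is $K_3\in\mathcal K$ with $K_3\subseteq K_1\cap K_2$. $Y$ is well-filtered if it is $T_0$ and for every open $U\subseteq Y$ and every filtered family $\mathcal K\subseteq\mathsf K(Y)$, $\bigcap\mathcal K\subseteq U$ implies $K\subseteq U$ for some $K\in\mathcal K$. A nonempty subset $A$ of a space is irreducible if whenever $A\subseteq F_1\cup F_2$ with $F_1,F_2$ closed, then $A\subseteq F_1$ or $A\subseteq F_2$. A subset $A$ of a $T_0$ space $X$ is well-filtered determined if for every continuous map $f:X\to Y$ to a well-filtered space $Y$ there is a unique $y_A\in Y$ with $\overline{f(A)}=\overline{\{y_A\}}$. A $T_0$ space $X$ is well-filtered determined if every irreducible closed subset of $X$ is well-filtered determined. *)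

theory Defs
  imports "HOL-Analysis.Analysis" "HOL-Algebra.Complete_Lattice"
begin

definition directed_in :: "('a, 'm) gorder_scheme \<Rightarrow> 'a set \<Rightarrow> bool" where
  "directed_in L D \<longleftrightarrow> D \<noteq> {} \<and> D \<subseteq> carrier L \<and>
     (\<forall>x\<in>D. \<forall>y\<in>D. \<exists>z\<in>D. x \<sqsubseteq>\<^bsub>L\<^esub> z \<and> y \<sqsubseteq>\<^bsub>L\<^esub> z)"

definition way_below :: "('a, 'm) gorder_scheme \<Rightarrow> 'a \<Rightarrow> 'a \<Rightarrow> bool" where
  "way_below L x y \<longleftrightarrow> x \<in> carrier L \<and> y \<in> carrier L \<and>
     (\<forall>D s. directed_in L D \<and> is_lub L s D \<and> y \<sqsubseteq>\<^bsub>L\<^esub> s \<longrightarrow> (\<exists>d\<in>D. x \<sqsubseteq>\<^bsub>L\<^esub> d))"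

text \<open>In a complete lattice the set of elements way below \<open>y\<close> is automatically directed,
  so directedness is not listed as a separate requirement.\<close>

definition continuous_lattice :: "('a, 'm) gorder_scheme \<Rightarrow> bool" where
  "continuous_lattice L \<longleftrightarrow> complete_lattice L \<and>
     (\<forall>y \<in> carrier L. is_lub L y {x. way_below L x y})"

definition open_sets_order :: "'a topology \<Rightarrow> 'a set gorder" where
  "open_sets_order X = \<lparr>carrier = {U. openin X U}, eq = (=), le = (\<subseteq>)\<rparr>"

definition core_compact :: "'a topology \<Rightarrow> bool" where
  "core_compact X \<longleftrightarrow> continuous_lattice (open_sets_order X)"

definition specializes :: "'a topology \<Rightarrow> 'a \<Rightarrow> 'a \<Rightarrow> bool" where
  "specializes Y x y \<longleftrightarrow> x \<in> topspace Y \<and> y \<in> topspace Y \<and> x \<in> Y closure_of {y}"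

definition saturatedin :: "'a topology \<Rightarrow> 'a set \<Rightarrow> bool" where
  "saturatedin Y A \<longleftrightarrow> A \<subseteq> topspace Y \<and> (\<forall>x\<in>A. \<forall>y. specializes Y x y \<longrightarrow> y \<in> A)"

definition compact_saturated_sets :: "'a topology \<Rightarrow> 'a set set" where
  "compact_saturated_sets Y = {K. K \<noteq> {} \<and> compactin Y K \<and> saturatedin Y K}"

definition filtered_family :: "'a set set \<Rightarrow> bool" where
  "filtered_family \<K> \<longleftrightarrow> \<K> \<noteq> {} \<and> (\<forall>K1\<in>\<K>. \<forall>K2\<in>\<K>. \<exists>K3\<in>\<K>. K3 \<subseteq> K1 \<inter> K2)"

definition well_filtered_space :: "'a topology \<Rightarrow> bool" where
  "well_filtered_space Y \<longleftrightarrow> t0_space Y \<and>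
     (\<forall>U \<K>. openin Y U \<and> \<K> \<subseteq> compact_saturated_sets Y \<and> filtered_family \<K> \<and> \<Inter>\<K> \<subseteq> U
        \<longrightarrow> (\<exists>K\<in>\<K>. K \<subseteq> U))"

definition irreduciblein :: "'a topology \<Rightarrow> 'a set \<Rightarrow> bool" where
  "irreduciblein X A \<longleftrightarrow> A \<noteq> {} \<and> A \<subseteq> topspace X \<and>
     (\<forall>F1 F2. closedin X F1 \<and> closedin X F2 \<and> A \<subseteq> F1 \<union> F2 \<longrightarrow> A \<subseteq> F1 \<or> A \<subseteq> F2)"

text \<open>A definition cannot quantify over the types that carry the target spaces \<open>Y\<close>; the carrier
  type \<open>'b\<close> is therefore an explicit parameter.  Being well-filtered determined in the usual sense
  means satisfying these predicates at every type \<open>'b\<close>, i.e. as a theorem with \<open>'b\<close>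
  an unconstrained type variable that does not occur in the hypotheses.\<close>

definition well_filtered_determined_set :: "'b itself \<Rightarrow> 'a topology \<Rightarrow> 'a set \<Rightarrow> bool" where
  "well_filtered_determined_set (_ :: 'b itself) X A \<longleftrightarrow> A \<subseteq> topspace X \<and>
     (\<forall>(Y :: 'b topology) f. well_filtered_space Y \<and> continuous_map X Y f \<longrightarrow>
        (\<exists>!y. y \<in> topspace Y \<and> Y closure_of (f ` A) = Y closure_of {y}))"

definition well_filtered_determined_space :: "'b itself \<Rightarrow> 'a topology \<Rightarrow> bool" where
  "well_filtered_determined_space (T :: 'b itself) X \<longleftrightarrow> t0_space X \<and>
     (\<forall>A. irreduciblein X A \<and> closedin X A \<longrightarrow> well_filtered_determined_set T X A)"

end

theory Submission
  imports Defs
begin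

text \<open>Call a descending sequence of sets \<open>S n\<close> a rapid sequence if every directed open cover of
  \<open>S n\<close> has a member containing \<open>S (n + 1)\<close>. In a well-filtered space the intersection \<open>K\<close> of all
  open sets that contain some \<open>S n\<close> is compact saturated, and every open set containing \<open>K\<close> already
  contains some \<open>S n\<close>: this is a countable Hofmann--Mislove theorem, whose key step picks points
  \<open>x n \<in> S n\<close> outside a maximal open set containing no \<open>S n\<close>; all tails of that
  sequence are compact, so well-filteredness applies to their saturations.

  Let \<open>A\<close> be irreducible in a core compact space and \<open>f\<close> continuous into a well-filtered space.
  By interpolation, \<open>V \<lless> U\<close> gives a \<open>\<lless>\<close>-descending sequence between \<open>V\<close> and \<open>U\<close>, whose image under
  \<open>f\<close> is rapid. The compact saturated sets obtained from sequences bounded below by open sets meeting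
  \<open>A\<close> form a filtered family, because the open sets meeting \<open>A\<close> form a filter. Each of them meets the
  closure of \<open>f ` A\<close>, hence so does their intersection, in a point that must be generic.\<close>

section \<open>The way-below relation on open sets\<close>

lemma carrier_open_sets_order [simp]: "carrier (open_sets_order X) = {U. openin X U}"
  by (simp add: open_sets_order_def)

lemma le_open_sets_order [simp]: "le (open_sets_order X) = (\<subseteq>)"
  by (simp add: open_sets_order_def)

lemma is_lub_open_sets_order:
  assumes "\<And>U. U \<in> D \<Longrightarrow> openin X U"
  shows "is_lub (open_sets_order X) s D \<longleftrightarrow> s = \<Union>D"
proof -
  have "openin X (\<Union>D)" using assms by blast
  then show ?thesis
    using assms unfolding least_def Upper_def by (auto dest: openin_subset)
qed

lemma directed_in_open_sets_order:
  "directed_in (open_sets_order X) D \<longleftrightarrow>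
    D \<noteq> {} \<and> (\<forall>U\<in>D. openin X U) \<and> (\<forall>U\<in>D. \<forall>V\<in>D. \<exists>W\<in>D. U \<subseteq> W \<and> V \<subseteq> W)"
  unfolding directed_in_def by auto

abbreviation way_below_open :: "'a topology \<Rightarrow> 'a set \<Rightarrow> 'a set \<Rightarrow> bool" where
  "way_below_open X \<equiv> way_below (open_sets_order X)"

text \<open>A directed family of open sets has exactly its union as least upper bound, so the bound
  \<open>s\<close> can be eliminated.\<close>

lemma way_below_open_iff:
  "way_below_open X V U \<longleftrightarrow> openin X V \<and> openin X U \<and>
    (\<forall>D. directed_in (open_sets_order X) D \<and> U \<subseteq> \<Union>D \<longrightarrow> (\<exists>d\<in>D. V \<subseteq> d))"
proof -
  have "is_lub (open_sets_order X) s D \<longleftrightarrow> s = \<Union>D"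
    if "directed_in (open_sets_order X) D" for s D
    using that by (intro is_lub_open_sets_order) (auto simp: directed_in_open_sets_order)
  then show ?thesis unfolding way_below_def by auto
qed

lemma way_below_open_subset:
  assumes "way_below_open X V U" shows "V \<subseteq> U"
proof -
  have "directed_in (open_sets_order X) {U}"
    using assms by (auto simp: way_below_open_iff directed_in_open_sets_order)
  then show ?thesis using assms unfolding way_below_open_iff by blast
qed

lemma way_below_open_Un:
  assumes "way_below_open X V1 U1" "way_below_open X V2 U2"
  shows "way_below_open X (V1 \<union> V2) (U1 \<union> U2)"
  unfolding way_below_open_iff
proof (intro conjI allI impI)
  fix D assume D: "directed_in (open_sets_order X) D \<and> U1 \<union> U2 \<subseteq> \<Union>D"
  then obtain d1 d2 where "d1 \<in> D" "V1 \<subseteq> d1" "d2 \<in> D" "V2 \<subseteq> d2"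
    using assms unfolding way_below_open_iff by (metis le_sup_iff)
  moreover from this obtain d where "d \<in> D" "d1 \<subseteq> d" "d2 \<subseteq> d"
    using D unfolding directed_in_open_sets_order by meson
  ultimately show "\<exists>d\<in>D. V1 \<union> V2 \<subseteq> d" by blast
qed (use assms in \<open>auto simp: way_below_open_iff\<close>)

lemma core_compact_way_below:
  assumes "core_compact X" "openin X U" "x \<in> U"
  obtains V where "way_below_open X V U" "x \<in> V"
proof -
  have "is_lub (open_sets_order X) U {V. way_below_open X V U}"
    using assms unfolding core_compact_def continuous_lattice_def by simp
  then have "U = \<Union>{V. way_below_open X V U}"
    by (subst (asm) is_lub_open_sets_order) (auto simp: way_below_open_iff)
  then show ?thesis using assms(3) that by blast
qed

text \<open>The family \<open>D\<close> of sets two way-below steps under \<open>U\<close> is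
  directed and covers \<open>U\<close>, by applying core compactness twice; since \<open>V\<close>
  is way below \<open>U\<close>, it lies inside a member of \<open>D\<close>.\<close>

lemma way_below_open_interpolate:
  assumes "core_compact X" "way_below_open X V U"
  obtains W where "way_below_open X V W" "way_below_open X W U"
proof -
  define D where "D = {Z. \<exists>W. way_below_open X Z W \<and> way_below_open X W U}"
  have openU: "openin X U" using assms(2) by (simp add: way_below_open_iff)
  have "way_below_open X {} {}"
    by (auto simp: way_below_open_iff directed_in_open_sets_order)
  moreover have "way_below_open X {} U"
    using openU by (auto simp: way_below_open_iff directed_in_open_sets_order)
  ultimately have "{} \<in> D" unfolding D_def by blast
  moreover have "Z1 \<union> Z2 \<in> D" if "Z1 \<in> D" "Z2 \<in> D" for Z1 Z2
    using that way_below_open_Un unfolding D_def by (smt (verit) mem_Collect_eq sup.idem)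
  moreover have "\<forall>Z\<in>D. openin X Z" unfolding D_def way_below_open_iff by blast
  ultimately have "directed_in (open_sets_order X) D"
    unfolding directed_in_open_sets_order by (metis Un_upper1 Un_upper2 empty_iff)
  moreover have "U \<subseteq> \<Union>D"
  proof
    fix x assume "x \<in> U"
    then obtain W where W: "way_below_open X W U" "x \<in> W"
      using core_compact_way_below[OF assms(1) openU] by metis
    then have "openin X W" by (simp add: way_below_open_iff)
    then obtain Z where "way_below_open X Z W" "x \<in> Z"
      using core_compact_way_below[OF assms(1) _ W(2)] by metis
    with W(1) show "x \<in> \<Union>D" unfolding D_def by blast
  qed
  ultimately obtain Z where Z: "Z \<in> D" "V \<subseteq> Z"
    using assms(2) unfolding way_below_open_iff by blast
  then obtain W where W: "way_below_open X Z W" "way_below_open X W U" unfolding D_def by blast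
  then have "way_below_open X V W"
    using Z(2) assms(2) unfolding way_below_open_iff by (meson order_trans)
  with W(2) show ?thesis using that by blast
qed

text \<open>Interpolate repeatedly between \<open>V\<close> and the current term, starting at
  \<open>U\<close>; keeping \<open>V\<close> way below each term allows the next step.\<close>

lemma way_below_open_sequence:
  assumes "core_compact X" "way_below_open X V U"
  obtains W :: "nat \<Rightarrow> 'a set" where "\<And>n. way_below_open X V (W n)" "\<And>n. W n \<subseteq> U"
    "\<And>n. way_below_open X (W (Suc n)) (W n)"
proof -
  have "\<exists>W. \<forall>n. (way_below_open X V (W n) \<and> W n \<subseteq> U) \<and> way_below_open X (W (Suc n)) (W n)"
  proof (rule dependent_nat_choice)
    fix W n
    assume "way_below_open X V W \<and> W \<subseteq> U"
    then show "\<exists>W'. (way_below_open X V W' \<and> W' \<subseteq> U) \<and> way_below_open X W' W"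
      by (meson way_below_open_interpolate[OF assms(1)] way_below_open_subset subset_trans)
  qed (use assms(2) in blast)
  then show ?thesis using that by blast
qed

section \<open>Saturation\<close>

text \<open>This is the upward closure of \<open>S\<close> in the specialization order.\<close>

definition saturation :: "'a topology \<Rightarrow> 'a set \<Rightarrow> 'a set" where
  "saturation Y S = {y \<in> topspace Y. \<exists>x\<in>S. x \<in> Y closure_of {y}}"

lemma saturation_superset: "S \<subseteq> topspace Y \<Longrightarrow> S \<subseteq> saturation Y S"
  unfolding saturation_def by (auto simp: in_closure_of)

text \<open>Open sets are upper sets for specialization, so saturating does not change the open
  supersets; finite subcovers thus carry over to the saturation.\<close>

lemma saturation_subset_open: "openin Y U \<Longrightarrow> saturation Y S \<subseteq> U \<longleftrightarrow> S \<inter> topspace Y \<subseteq> U"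
  unfolding saturation_def by (auto simp: in_closure_of)

lemma saturation_mono: "S \<subseteq> T \<Longrightarrow> saturation Y S \<subseteq> saturation Y T"
  unfolding saturation_def by blast

lemma saturatedin_saturation: "saturatedin Y (saturation Y S)"
  unfolding saturation_def saturatedin_def specializes_def by (auto simp: in_closure_of)

lemma compactin_saturation:
  assumes "compactin Y S" shows "compactin Y (saturation Y S)"
  unfolding compactin_def
proof (intro conjI allI impI)
  show "saturation Y S \<subseteq> topspace Y" by (auto simp: saturation_def)
next
  fix \<U> assume U: "(\<forall>U\<in>\<U>. openin Y U) \<and> saturation Y S \<subseteq> \<Union>\<U>"
  have S: "S \<subseteq> topspace Y" using assms by (simp add: compactin_def)
  then have "S \<subseteq> \<Union>\<U>" using U saturation_superset by blast
  then obtain \<F> where F: "finite \<F>" "\<F> \<subseteq> \<U>" "S \<subseteq> \<Union>\<F>"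
    using assms U unfolding compactin_def by meson
  then have "openin Y (\<Union>\<F>)" using U by blast
  then have "saturation Y S \<subseteq> \<Union>\<F>"
    using F(3) by (simp add: saturation_subset_open le_infI1)
  with F(1,2) show "\<exists>\<F>. finite \<F> \<and> \<F> \<subseteq> \<U> \<and> saturation Y S \<subseteq> \<Union>\<F>" by blast
qed

lemma well_filtered_spaceE:
  assumes "well_filtered_space Y" "\<K> \<subseteq> compact_saturated_sets Y" "filtered_family \<K>"
    "openin Y U" "\<Inter>\<K> \<subseteq> U"
  obtains K where "K \<in> \<K>" "K \<subseteq> U"
  using assms unfolding well_filtered_space_def by meson

section \<open>Rapid sequences\<close>

text \<open>Consecutive terms satisfy the covering condition of the way-below relation but need not
  be open, so that images of open sets under continuous maps can qualify.\<close>

definition rapid_sequence :: "'a topology \<Rightarrow> (nat \<Rightarrow> 'a set) \<Rightarrow> bool" where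
  "rapid_sequence Y S \<longleftrightarrow> decseq S \<and> S 0 \<subseteq> topspace Y \<and>
    (\<forall>n D. directed_in (open_sets_order Y) D \<and> S n \<subseteq> \<Union>D \<longrightarrow> (\<exists>d\<in>D. S (Suc n) \<subseteq> d))"

text \<open>For a rapid \<open>S\<close>, the open sets containing some \<open>S n\<close> form a
  Scott open filter; this is its intersection, as in the Hofmann--Mislove theorem.\<close>

definition open_kernel :: "'a topology \<Rightarrow> (nat \<Rightarrow> 'a set) \<Rightarrow> 'a set" where
  "open_kernel Y S = {y \<in> topspace Y. \<forall>U n. openin Y U \<and> S n \<subseteq> U \<longrightarrow> y \<in> U}"

lemma rapid_sequenceD:
  assumes "rapid_sequence Y S" "directed_in (open_sets_order Y) D" "S n \<subseteq> \<Union>D"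
  obtains d where "d \<in> D" "S (Suc n) \<subseteq> d"
  using assms unfolding rapid_sequence_def by meson

lemma saturatedin_open_kernel: "saturatedin Y (open_kernel Y S)"
  unfolding open_kernel_def saturatedin_def specializes_def by (auto simp: in_closure_of)

lemma open_kernel_mono:
  assumes "\<And>m n. S m \<subseteq> T n" shows "open_kernel Y S \<subseteq> open_kernel Y T"
  using assms unfolding open_kernel_def by (smt (verit) Collect_mono subset_trans)

text \<open>Zorn's lemma applies: a chain is directed, so if its union contained \<open>S n\<close>,
  rapidity would place \<open>S (n + 1)\<close> inside one member. The last property is maximality,
  as \<open>M \<union> V\<close> is strictly larger than \<open>M\<close>.\<close>

lemma rapid_sequence_maximal_open:
  assumes "rapid_sequence Y S" "openin Y U" "\<And>n. \<not> S n \<subseteq> U"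
  obtains M where "openin Y M" "U \<subseteq> M" "\<And>n. \<not> S n \<subseteq> M"
    "\<And>V. openin Y V \<Longrightarrow> \<not> V \<subseteq> M \<Longrightarrow> \<exists>n. S n \<subseteq> M \<union> V"
proof -
  let ?P = "{V. openin Y V \<and> U \<subseteq> V \<and> (\<forall>n. \<not> S n \<subseteq> V)}"
  have "\<exists>M\<in>?P. \<forall>V\<in>?P. M \<subseteq> V \<longrightarrow> V = M"
  proof (rule subset_Zorn_nonempty)
    show "?P \<noteq> {}" using assms by blast
  next
    fix C assume C: "C \<noteq> {}" "subset.chain ?P C"
    have sub: "C \<subseteq> ?P" using C(2) unfolding subset.chain_def by blast
    have tot: "V \<subseteq> V' \<or> V' \<subseteq> V" if "V \<in> C" "V' \<in> C" for V V'
      using C(2) that unfolding subset_chain_def by blast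
    have "directed_in (open_sets_order Y) C"
      unfolding directed_in_open_sets_order
    proof (intro conjI ballI)
      fix V V' assume "V \<in> C" "V' \<in> C"
      then show "\<exists>W\<in>C. V \<subseteq> W \<and> V' \<subseteq> W" using tot by (metis subset_refl)
    qed (use C(1) sub in auto)
    then have "\<not> S n \<subseteq> \<Union>C" for n
      using rapid_sequenceD[OF assms(1)] sub by (metis (mono_tags, lifting) mem_Collect_eq subset_iff)
    moreover have "openin Y (\<Union>C)" "U \<subseteq> \<Union>C" using C(1) sub by blast+
    ultimately show "\<Union>C \<in> ?P" by blast
  qed
  then obtain M where M: "M \<in> ?P" "\<forall>V\<in>?P. M \<subseteq> V \<longrightarrow> V = M" by (rule bexE)
  show ?thesis
  proof (rule that[of M])
    fix V assume "openin Y V" "\<not> V \<subseteq> M"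
    then have "M \<union> V \<notin> ?P" using M(2) by blast
    then show "\<exists>n. S n \<subseteq> M \<union> V" using M(1) \<open>openin Y V\<close> by blast
  qed (use M(1) in auto)
qed

text \<open>A cover member around \<open>x 0\<close> contains almost all terms, and each of the
  finitely many others takes one further member.\<close>

lemma compactin_range_if_eventually:
  fixes x :: "nat \<Rightarrow> 'a"
  assumes "range x \<subseteq> topspace Y"
    and ev: "\<And>V n. openin Y V \<Longrightarrow> x n \<in> V \<Longrightarrow> \<exists>m. \<forall>k\<ge>m. x k \<in> V"
  shows "compactin Y (range x)"
  unfolding compactin_def
proof (intro conjI allI impI)
  fix \<U> assume U: "(\<forall>U\<in>\<U>. openin Y U) \<and> range x \<subseteq> \<Union>\<U>"
  then have "\<forall>k. \<exists>V. V \<in> \<U> \<and> x k \<in> V" by blast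
  then obtain V where V: "\<And>k. V k \<in> \<U> \<and> x k \<in> V k" by metis
  then obtain m where m: "\<And>k. k \<ge> m \<Longrightarrow> x k \<in> V 0" using ev[of "V 0" 0] U by blast
  have "range x \<subseteq> \<Union>(V ` {..m})"
  proof clarify
    fix k show "x k \<in> \<Union>(V ` {..m})"
      using V[of k] V[of 0] m[of k] by (cases "k \<ge> m") (use nat_le_linear in blast)+
  qed
  then show "\<exists>\<F>. finite \<F> \<and> \<F> \<subseteq> \<U> \<and> range x \<subseteq> \<Union>\<F>"
    using V by (intro exI[of _ "V ` {..m}"]) auto
qed (fact assms(1))

lemma open_kernel_subset_open:
  assumes wf: "well_filtered_space Y" and S: "rapid_sequence Y S"
    and "openin Y U" "open_kernel Y S \<subseteq> U"
  obtains n where "S n \<subseteq> U"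
proof (rule ccontr)
  assume "\<not> thesis"
  then have "\<not> S n \<subseteq> U" for n using that by blast
  then obtain M where M: "openin Y M" "U \<subseteq> M" "\<And>n. \<not> S n \<subseteq> M"
    and max: "\<And>V. openin Y V \<Longrightarrow> \<not> V \<subseteq> M \<Longrightarrow> \<exists>n. S n \<subseteq> M \<union> V"
    using rapid_sequence_maximal_open[OF S assms(3)] by metis
  have "\<forall>n. \<exists>y. y \<in> S n \<and> y \<notin> M" using M(3) by blast
  then obtain x where x: "\<And>n. x n \<in> S n" "\<And>n. x n \<notin> M" by metis
  have dec: "S n \<subseteq> S m" if "m \<le> n" for m n
    using S that by (simp add: rapid_sequence_def decseq_def)
  have top: "x n \<in> topspace Y" for n
    using x(1)[of n] dec[of 0 n] S unfolding rapid_sequence_def by blast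
  \<comment> \<open>By maximality \<open>M \<union> V\<close> contains some \<open>S m\<close>; the
    points from \<open>x m\<close> on lie in \<open>S m\<close> but avoid \<open>M\<close>, hence
    lie in \<open>V\<close>.\<close>
  have ev: "\<exists>m. \<forall>k\<ge>m. x k \<in> V" if V: "openin Y V" "\<not> V \<subseteq> M" for V
  proof -
    obtain m where "S m \<subseteq> M \<union> V" using max[OF V] by blast
    then show ?thesis using x dec by blast
  qed
  \<comment> \<open>The tail from \<open>n\<close> lies in \<open>S n\<close>, which will force
    common points of the \<open>K n\<close> into the kernel, while every tail avoids
    \<open>M\<close>.\<close>
  define K where "K n = saturation Y (range (\<lambda>k. x (n + k)))" for n
  have "K n \<in> compact_saturated_sets Y" for n
  proof -
    have "compactin Y (range (\<lambda>k. x (n + k)))"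
    proof (rule compactin_range_if_eventually)
      fix V i assume "openin Y V" "x (n + i) \<in> V"
      then show "\<exists>m. \<forall>k\<ge>m. x (n + k) \<in> V"
        using ev[of V] x(2) by (metis subsetD trans_le_add2)
    qed (use top in auto)
    moreover have "K n \<noteq> {}"
      unfolding K_def using saturation_superset[of "range (\<lambda>k. x (n + k))" Y] top by blast
    ultimately show ?thesis
      by (simp add: K_def compact_saturated_sets_def compactin_saturation saturatedin_saturation)
  qed
  moreover have "filtered_family (range K)"
  proof -
    have "K (m + n) \<subseteq> K m \<inter> K n" for m n
    proof -
      have "range (\<lambda>k. x (m + n + k)) \<subseteq> range (\<lambda>k. x (m + k))"
        "range (\<lambda>k. x (m + n + k)) \<subseteq> range (\<lambda>k. x (n + k))"
        by (auto simp: image_iff) (metis add.assoc, metis add.assoc add.commute)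
      then show ?thesis unfolding K_def by (simp add: saturation_mono)
    qed
    then show ?thesis unfolding filtered_family_def by blast
  qed
  moreover have "\<not> K n \<subseteq> M" for n
    unfolding K_def saturation_subset_open[OF M(1)] using x(2) top by blast
  ultimately have "\<not> \<Inter>(range K) \<subseteq> M"
    using wf M(1) unfolding well_filtered_space_def by blast
  then obtain z where z: "z \<notin> M" "\<And>n. z \<in> K n" by blast
  \<comment> \<open>The point \<open>z\<close> lies above some tail point in the specialization
    order, and \<open>V\<close> is an upper set containing that tail.\<close>
  have "z \<in> V" if V: "openin Y V" "S n \<subseteq> V" for V n
  proof -
    obtain k where "x (n + k) \<in> Y closure_of {z}" using z(2)[of n] unfolding K_def saturation_def by blast
    moreover have "x (n + k) \<in> V" using x(1)[of "n + k"] dec[of n "n + k"] V(2) by auto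
    ultimately show ?thesis using V(1) by (auto simp: in_closure_of)
  qed
  moreover have "z \<in> topspace Y" using z(2)[of 0] unfolding K_def saturation_def by blast
  ultimately have "z \<in> open_kernel Y S" unfolding open_kernel_def by blast
  then show False using assms(4) M(2) z(1) by blast
qed

text \<open>Finite unions of cover members form a directed family whose union contains some
  \<open>S n\<close>. Rapidity puts \<open>S (n + 1)\<close> in one of them, and any open superset
  of a term contains the kernel.\<close>

lemma compactin_open_kernel:
  assumes wf: "well_filtered_space Y" and S: "rapid_sequence Y S"
  shows "compactin Y (open_kernel Y S)"
  unfolding compactin_def
proof (intro conjI allI impI)
  show "open_kernel Y S \<subseteq> topspace Y" by (auto simp: open_kernel_def)
next
  fix \<U> assume U: "(\<forall>U\<in>\<U>. openin Y U) \<and> open_kernel Y S \<subseteq> \<Union>\<U>"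
  define D where "D = {\<Union>\<F> |\<F>. finite \<F> \<and> \<F> \<subseteq> \<U>}"
  have "{} \<in> D" unfolding D_def by auto
  moreover have "V \<union> W \<in> D" if V: "V \<in> D" "W \<in> D" for V W
  proof -
    obtain \<F> \<G> where "V = \<Union>\<F>" "W = \<Union>\<G>" "finite \<F>" "\<F> \<subseteq> \<U>" "finite \<G>" "\<G> \<subseteq> \<U>"
      using V unfolding D_def by blast
    then have "V \<union> W = \<Union>(\<F> \<union> \<G>) \<and> finite (\<F> \<union> \<G>) \<and> \<F> \<union> \<G> \<subseteq> \<U>" by auto
    then show ?thesis unfolding D_def mem_Collect_eq by (rule exI)
  qed
  moreover have "\<forall>V\<in>D. openin Y V" unfolding D_def using U by blast
  ultimately have dir: "directed_in (open_sets_order Y) D"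
    unfolding directed_in_open_sets_order by (metis Un_upper1 Un_upper2 empty_iff)
  have "openin Y (\<Union>\<U>)" using U by blast
  then obtain n where "S n \<subseteq> \<Union>\<U>" using open_kernel_subset_open[OF wf S] U by metis
  moreover have "\<Union>\<U> \<subseteq> \<Union>D"
  proof
    fix y assume "y \<in> \<Union>\<U>"
    then obtain V where "V \<in> \<U>" "y \<in> V" by blast
    moreover from this have "\<Union>{V} \<in> D" unfolding D_def by blast
    ultimately show "y \<in> \<Union>D" by auto
  qed
  ultimately obtain d where d: "d \<in> D" "S (Suc n) \<subseteq> d"
    using rapid_sequenceD[OF S dir] by (metis subset_trans)
  then have "open_kernel Y S \<subseteq> d"
    using \<open>\<forall>V\<in>D. openin Y V\<close> unfolding open_kernel_def by blast
  with d(1) show "\<exists>\<F>. finite \<F> \<and> \<F> \<subseteq> \<U> \<and> open_kernel Y S \<subseteq> \<Union>\<F>"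
    unfolding D_def by blast
qed

text \<open>Preimages turn a directed open cover of the image of \<open>W n\<close> into one of
  \<open>W n\<close> itself, where the way-below relation applies.\<close>

lemma rapid_sequence_image:
  assumes f: "continuous_map X Y f" and W: "\<And>n. way_below_open X (W (Suc n)) (W n)"
  shows "rapid_sequence Y (\<lambda>n. f ` W n)"
  unfolding rapid_sequence_def
proof (intro conjI allI impI)
  show "decseq (\<lambda>n. f ` W n)"
    using way_below_open_subset[OF W] by (intro decseq_SucI image_mono)
  have top: "W n \<subseteq> topspace X" for n
    using W[of n] by (auto simp: way_below_open_iff dest: openin_subset)
  then show "f ` W 0 \<subseteq> topspace Y"
    using f by (meson continuous_map_image_subset_topspace image_mono subset_trans)
  fix n D assume D: "directed_in (open_sets_order Y) D \<and> f ` W n \<subseteq> \<Union>D"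
  define g where "g V = {x \<in> topspace X. f x \<in> V}" for V
  have "directed_in (open_sets_order X) (g ` D)"
    unfolding directed_in_open_sets_order
  proof (intro conjI ballI)
    show "g ` D \<noteq> {}" using D unfolding directed_in_open_sets_order by blast
  next
    fix U assume "U \<in> g ` D"
    then show "openin X U"
      using D f unfolding directed_in_open_sets_order g_def
      by (auto intro: openin_continuous_map_preimage)
  next
    fix U V assume "U \<in> g ` D" "V \<in> g ` D"
    then obtain U' V' where "U = g U'" "V = g V'" "U' \<in> D" "V' \<in> D" by blast
    moreover from this obtain W' where "W' \<in> D" "U' \<subseteq> W'" "V' \<subseteq> W'"
      using D unfolding directed_in_open_sets_order by meson
    moreover from this have "g U' \<subseteq> g W'" "g V' \<subseteq> g W'" unfolding g_def by blast+
    ultimately show "\<exists>W\<in>g ` D. U \<subseteq> W \<and> V \<subseteq> W" by (metis imageI)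
  qed
  moreover have "W n \<subseteq> \<Union>(g ` D)" using D top unfolding g_def by blast
  ultimately have "\<exists>d\<in>g ` D. W (Suc n) \<subseteq> d" using W[of n] unfolding way_below_open_iff by blast
  then show "\<exists>d\<in>D. f ` W (Suc n) \<subseteq> d" unfolding g_def by blast
qed

section \<open>Irreducible sets in core compact spaces\<close>

text \<open>This is irreducibility applied to the complements of \<open>U\<close> and
  \<open>V\<close>; it is what makes the family of kernels filtered.\<close>

lemma irreduciblein_openin_Int:
  assumes "irreduciblein X A" "openin X U" "openin X V" "U \<inter> A \<noteq> {}" "V \<inter> A \<noteq> {}"
  shows "U \<inter> V \<inter> A \<noteq> {}"
proof
  assume "U \<inter> V \<inter> A = {}"
  then have "A \<subseteq> (topspace X - U) \<union> (topspace X - V)"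
    using assms(1) unfolding irreduciblein_def by blast
  then have "A \<subseteq> topspace X - U \<or> A \<subseteq> topspace X - V"
    using assms(1-3) unfolding irreduciblein_def by (meson closedin_diff closedin_topspace)
  then show False using assms(4,5) by blast
qed

lemma core_compact_irreducible_generic_point:
  assumes cc: "core_compact X" and A: "irreduciblein X A"
    and wf: "well_filtered_space Y" and f: "continuous_map X Y f"
  obtains y where "y \<in> topspace Y" "Y closure_of (f ` A) = Y closure_of {y}"
proof -
  \<comment> \<open>The common lower bound \<open>V\<close> keeps every term in contact with
    \<open>A\<close> and leaves room for a further sequence below all terms.\<close>
  define seqs where "seqs = {W. (\<forall>n. way_below_open X (W (Suc n)) (W n)) \<and>
      (\<exists>V. openin X V \<and> V \<inter> A \<noteq> {} \<and> (\<forall>n :: nat. V \<subseteq> W n))}"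
  define K where "K W = open_kernel Y (\<lambda>n. f ` W n)" for W
  have ex: "\<exists>W\<in>seqs. \<forall>n. W n \<subseteq> U" if U: "openin X U" "U \<inter> A \<noteq> {}" for U
  proof -
    obtain x where x: "x \<in> U" "x \<in> A" using U(2) by blast
    obtain V where V: "way_below_open X V U" "x \<in> V"
      using core_compact_way_below[OF cc U(1) x(1)] by metis
    obtain W where W: "\<And>n. way_below_open X V (W n)" "\<And>n. W n \<subseteq> U"
        "\<And>n. way_below_open X (W (Suc n)) (W n)"
      using way_below_open_sequence[OF cc V(1)] by metis
    have "openin X V" using V(1) by (simp add: way_below_open_iff)
    moreover have "V \<inter> A \<noteq> {}" using V(2) x(2) by blast
    ultimately have "W \<in> seqs"
      using W(3) way_below_open_subset[OF W(1)] unfolding seqs_def by blast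
    with W(2) show ?thesis by blast
  qed
  have rapid: "rapid_sequence Y (\<lambda>n. f ` W n)" if "W \<in> seqs" for W
    using that rapid_sequence_image[OF f] unfolding seqs_def by blast
  have meets: "W n \<inter> A \<noteq> {}" if "W \<in> seqs" for W n
    using that unfolding seqs_def by blast
  have K_open: "\<exists>n. f ` W n \<subseteq> U" if "W \<in> seqs" "openin Y U" "K W \<subseteq> U" for W U
    using open_kernel_subset_open[OF wf rapid] that unfolding K_def by metis
  have K_sub: "K W \<subseteq> U" if "openin Y U" "f ` W n \<subseteq> U" for W U n
    using that unfolding K_def open_kernel_def by blast
  let ?B = "Y closure_of (f ` A)"
  have fA: "f ` A \<subseteq> topspace Y"
    using A f unfolding irreduciblein_def
    by (meson continuous_map_image_subset_topspace image_mono subset_trans)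
  have css: "K ` seqs \<subseteq> compact_saturated_sets Y"
  proof clarify
    fix W assume W: "W \<in> seqs"
    \<comment> \<open>An empty kernel would lie in the open set \<open>{}\<close>, forcing the image
      of some \<open>W n\<close> to be empty.\<close>
    have "K W \<noteq> {}" using K_open[OF W, of "{}"] meets[OF W] by auto
    then show "K W \<in> compact_saturated_sets Y"
      unfolding compact_saturated_sets_def K_def
      by (simp add: compactin_open_kernel[OF wf rapid[OF W]] saturatedin_open_kernel)
  qed
  have filt: "filtered_family (K ` seqs)"
    unfolding filtered_family_def
  proof (intro conjI ballI)
    have "topspace X \<inter> A \<noteq> {}" using A unfolding irreduciblein_def by blast
    then show "K ` seqs \<noteq> {}" using ex[of "topspace X"] by blast
  next
    fix K1 K2 assume "K1 \<in> K ` seqs" "K2 \<in> K ` seqs"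
    then obtain W1 W2 where W: "W1 \<in> seqs" "K1 = K W1" "W2 \<in> seqs" "K2 = K W2" by blast
    obtain V1 where V1: "openin X V1" "V1 \<inter> A \<noteq> {}" "\<And>n. V1 \<subseteq> W1 n"
      using W(1) unfolding seqs_def by blast
    obtain V2 where V2: "openin X V2" "V2 \<inter> A \<noteq> {}" "\<And>n. V2 \<subseteq> W2 n"
      using W(3) unfolding seqs_def by blast
    \<comment> \<open>The intersection of the two lower bounds still meets \<open>A\<close>, so a
      sequence fits inside it and hence under every term of both sequences.\<close>
    obtain W' where W': "W' \<in> seqs" "\<And>n. W' n \<subseteq> V1 \<inter> V2"
      using ex[of "V1 \<inter> V2"] irreduciblein_openin_Int[OF A V1(1) V2(1) V1(2) V2(2)] V1(1) V2(1)
      by (meson openin_Int)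
    have "f ` W' m \<subseteq> f ` W1 n" "f ` W' m \<subseteq> f ` W2 n" for m n
      using W'(2)[of m] V1(3)[of n] V2(3)[of n] by blast+
    then have "K W' \<subseteq> K W1" "K W' \<subseteq> K W2"
      unfolding K_def by (meson open_kernel_mono)+
    then show "\<exists>K3\<in>K ` seqs. K3 \<subseteq> K1 \<inter> K2" using W W'(1) by blast
  qed
  \<comment> \<open>Such an inclusion would push the image of some \<open>W n\<close> off the
    closure \<open>?B\<close>, although \<open>W n\<close> meets \<open>A\<close>.\<close>
  have not_sub: "\<not> K W \<subseteq> topspace Y - ?B" if W: "W \<in> seqs" for W
  proof
    assume "K W \<subseteq> topspace Y - ?B"
    then obtain n where "f ` W n \<subseteq> topspace Y - ?B"
      using K_open[OF W] by (metis closedin_closure_of openin_diff openin_topspace)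
    then show False using meets[OF W, of n] closure_of_subset[OF fA] by blast
  qed
  have "openin Y (topspace Y - ?B)" by (simp add: openin_diff)
  then have "\<not> \<Inter>(K ` seqs) \<subseteq> topspace Y - ?B"
    using well_filtered_spaceE[OF wf css filt] not_sub by (metis (no_types, lifting) imageE)
  then obtain y where y: "y \<notin> topspace Y - ?B" "\<And>W. W \<in> seqs \<Longrightarrow> y \<in> K W" by blast
  obtain W0 where "W0 \<in> seqs" using filt unfolding filtered_family_def by blast
  then have yY: "y \<in> topspace Y" using y(2) unfolding K_def open_kernel_def by blast
  with y(1) have yB: "y \<in> ?B" by blast
  \<comment> \<open>The preimage of an open neighbourhood of \<open>f a\<close> meets
    \<open>A\<close>, so it contains a sequence whose kernel lies in that neighbourhood;
    \<open>y\<close> belongs to this kernel.\<close>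
  have "f ` A \<subseteq> Y closure_of {y}"
  proof clarify
    fix a assume a: "a \<in> A"
    have "y \<in> U" if U: "openin Y U" "f a \<in> U" for U
    proof -
      let ?V = "{x \<in> topspace X. f x \<in> U}"
      have "openin X ?V" using f U(1) by (rule openin_continuous_map_preimage)
      moreover have "?V \<inter> A \<noteq> {}" using a U(2) A unfolding irreduciblein_def by blast
      ultimately obtain W where W: "W \<in> seqs" "\<And>n. W n \<subseteq> ?V" using ex by meson
      then have "f ` W 0 \<subseteq> U" by blast
      then show ?thesis using K_sub[OF U(1)] y(2)[OF W(1)] by blast
    qed
    then show "f a \<in> Y closure_of {y}" using fA a by (auto simp: in_closure_of)
  qed
  then have "?B \<subseteq> Y closure_of {y}" by (simp add: closure_of_minimal)
  moreover have "Y closure_of {y} \<subseteq> ?B" using yB by (simp add: closure_of_minimal)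
  ultimately show ?thesis using that yY by blast
qed

text \<open>Each point lies in the closure of the other, so no open set separates them; this yields
  uniqueness of the generic point.\<close>

lemma t0_space_closure_of_singleton_inj:
  assumes "t0_space Y" "x \<in> topspace Y" "y \<in> topspace Y" "Y closure_of {x} = Y closure_of {y}"
  shows "x = y"
proof (rule ccontr)
  assume "x \<noteq> y"
  then obtain U where U: "openin Y U" "x \<notin> U \<longleftrightarrow> y \<in> U"
    using assms(1-3) unfolding t0_space_def by blast
  have "x \<in> Y closure_of {y}" "y \<in> Y closure_of {x}"
    using assms(2-4) by (metis closure_of_subset empty_subsetI insert_subset)+
  then show False using U by (auto simp: in_closure_of)
qed

theorem theorem6p15:
  fixes X :: "'a topology"
  assumes "t0_space X" and "core_compact X"
  shows "well_filtered_determined_space TYPE('b) X"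
  unfolding well_filtered_determined_space_def well_filtered_determined_set_def
proof (intro conjI allI impI)
  fix A and Y :: "'b topology" and f
  assume A: "irreduciblein X A \<and> closedin X A"
    and Y: "well_filtered_space Y \<and> continuous_map X Y f"
  then obtain y where y: "y \<in> topspace Y" "Y closure_of (f ` A) = Y closure_of {y}"
    using core_compact_irreducible_generic_point[OF assms(2)] by metis
  moreover have "t0_space Y" using Y unfolding well_filtered_space_def by blast
  ultimately show "\<exists>!y. y \<in> topspace Y \<and> Y closure_of (f ` A) = Y closure_of {y}"
    using t0_space_closure_of_singleton_inj by metis
qed (use assms(1) in \<open>auto simp: irreduciblein_def\<close>)

end
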